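(* Let $X$ be a first countable Hausdorff topological space such that all closed subsets of $X$ are separable, let $x=(x_n)_{n\in\mathbf{N}}$ be a sequence with values in $X$, and let $\mathcal{I}$ be an analytic P-ideal on $\mathbf{N}$. Define $$\tilde{\Sigma}_x(\mathcal{I}):=\{\sigma\in\Sigma:\Lambda_{\sigma(x)}(\mathcal{I})=\Lambda_x(\mathcal{I})\}\quad\text{and}\quad \tilde{\Pi}_x(\mathcal{I}):=\{\pi\in\Pi:\Lambda_{\pi(x)}(\mathcal{I})=\Lambda_x(\mathcal{I})\}.$$ Then the following are equivalent: (1) $\tilde{\Sigma}_x(\mathcal{I})$ is comeager in $\Sigma$; (2) $\tilde{\Sigma}_x(\mathcal{I})$ is not meager in $\Sigma$; (3) $\tilde{\Pi}_x(\mathcal{I})$ is comeager in $\Pi$; (4) $\tilde{\Pi}_x(\mathcal{I})$ is not meager in $\Pi$; (5) $\Lambda_x(\mathcal{I})=\mathrm{L}_x$.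
   Context: $\mathbf{N}$ denotes the positive integers. An ideal on $\mathbf{N}$ is a family $\mathcal{I}\subseteq\mathcal{P}(\mathbf{N})$ closed under subsets and finite unions; it is always assumed that $\mathcal{I}$ contains the ideal $\mathrm{Fin}$ of all finite subsets of $\mathbf{N}$ and that $\mathcal{I}\neq\mathcal{P}(\mathbf{N})$. $\mathcal{I}$ is a P-ideal if for every sequence $(A_n)$ of sets in $\mathcal{I}$ there exists $A\in\mathcal{I}$ such that $A_n\setminus A$ is finite for all $n$. Ideals are regarded as subsets of the Cantor space $\{0,1\}^{\mathbf{N}}$ (identifying sets with characteristic functions); $\mathcal{I}$ is analytic if it is an analytic subset of this space. For a sequence $x=(x_n)$ in a topological space $X$, a point $\ell\in X$ is an $\mathcal{I}$-limit point of $x$ if there exists a subsequence $(x_{n_k})$ such that $\lim_{k\to\infty}x_{n_k}=\ell$ and $\{n_k:k\in\mathbf{N}\}\notin\mathcal{I}$. $\Lambda_x(\mathcal{I})$ is the set of $\mathcal{I}$-limit points of $x$. $\mathrm{L}_x$ is the set of ordinary accumulation points of $x$, i.e. of those $\ell\in X$ such that $\{n\in\mathbf{N}:x_n\in U\}$ is infinite for every neighborhood $U$ of $\ell$. $\Sigma$ is the set of strictly increasing functions $\sigma:\mathbf{N}\to\mathbf{N}$ and $\Pi$ is the set of bijections $\pi:\mathbf{N}\to\mathbf{N}$; both carry the subspace topology from $\mathbf{N}^{\mathbf{N}}$ (product of discrete topologies), and are Polish. For $\sigma\in\Sigma$, $\sigma(x)$ denotes the subsequence $(x_{\sigma(n)})_n$;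 for $\pi\in\Pi$, $\pi(x)$ denotes the rearranged sequence $(x_{\pi(n)})_n$. *)

theory Defs
  imports "HOL-Analysis.Analysis"
begin

text \<open>
  The type \<^typ>\<open>nat\<close> serves as the countable linearly ordered index set in place of the positive
  integers; none of the notions below depends on whether indices start from 0 or from 1.
  The types \<^typ>\<open>nat \<Rightarrow> bool\<close> and \<^typ>\<open>nat \<Rightarrow> nat\<close> carry the library's product topology of discrete
  spaces, i.e. they are the Cantor space and the Baire space.
\<close>

section \<open>Baire category\<close>

definition nowhere_dense_in :: "'a topology \<Rightarrow> 'a set \<Rightarrow> bool" where
  "nowhere_dense_in T S \<longleftrightarrow> S \<subseteq> topspace T \<and> T interior_of (T closure_of S) = {}"

definition meager_in :: "'a topology \<Rightarrow> 'a set \<Rightarrow> bool" where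
  "meager_in T S \<longleftrightarrow> (\<exists>F :: nat \<Rightarrow> 'a set. (\<forall>n. nowhere_dense_in T (F n)) \<and> S = (\<Union>n. F n))"

definition comeager_in :: "'a topology \<Rightarrow> 'a set \<Rightarrow> bool" where
  "comeager_in T S \<longleftrightarrow> S \<subseteq> topspace T \<and> meager_in T (topspace T - S)"

section \<open>Ideals\<close>

definition ideal_on_nat :: "nat set set \<Rightarrow> bool" where
  "ideal_on_nat I \<longleftrightarrow>
     (\<forall>A B. A \<in> I \<longrightarrow> B \<subseteq> A \<longrightarrow> B \<in> I) \<and>
     (\<forall>A B. A \<in> I \<longrightarrow> B \<in> I \<longrightarrow> A \<union> B \<in> I) \<and>
     (\<forall>A. finite A \<longrightarrow> A \<in> I) \<and>
     I \<noteq> UNIV"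

definition P_ideal :: "nat set set \<Rightarrow> bool" where
  "P_ideal I \<longleftrightarrow> ideal_on_nat I \<and>
     (\<forall>A :: nat \<Rightarrow> nat set. (\<forall>n. A n \<in> I) \<longrightarrow> (\<exists>B\<in>I. \<forall>n. finite (A n - B)))"

text \<open>Analytic subsets (of a Polish space): the empty set and the continuous images of the
  Baire space.\<close>

definition analytic_set :: "'a::topological_space set \<Rightarrow> bool" where
  "analytic_set S \<longleftrightarrow>
     S = {} \<or> (\<exists>f :: (nat \<Rightarrow> nat) \<Rightarrow> 'a. continuous_on UNIV f \<and> range f = S)"

definition analytic_ideal :: "nat set set \<Rightarrow> bool" where
  "analytic_ideal I \<longleftrightarrow> ideal_on_nat I \<and> analytic_set ((\<lambda>A :: nat set. \<lambda>n. n \<in> A) ` I)"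

section \<open>Limit points of sequences\<close>

definition ideal_limit_points :: "nat set set \<Rightarrow> (nat \<Rightarrow> 'a::topological_space) \<Rightarrow> 'a set" where
  "ideal_limit_points I x =
     {l. \<exists>k :: nat \<Rightarrow> nat. strict_mono k \<and> (x \<circ> k) \<longlonglongrightarrow> l \<and> range k \<notin> I}"

definition accumulation_points :: "(nat \<Rightarrow> 'a::topological_space) \<Rightarrow> 'a set" where
  "accumulation_points x = {l. \<forall>U. open U \<longrightarrow> l \<in> U \<longrightarrow> infinite {n. x n \<in> U}}"

section \<open>Subsequences and rearrangements\<close>

definition Sig :: "(nat \<Rightarrow> nat) set" where
  "Sig = {\<sigma>. strict_mono \<sigma>}"

definition Perms :: "(nat \<Rightarrow> nat) set" where
  "Perms = {\<pi>. bij \<pi>}"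

definition Sig_tilde :: "(nat \<Rightarrow> 'a::topological_space) \<Rightarrow> nat set set \<Rightarrow> (nat \<Rightarrow> nat) set" where
  "Sig_tilde x I = {\<sigma> \<in> Sig. ideal_limit_points I (x \<circ> \<sigma>) = ideal_limit_points I x}"

definition Perms_tilde :: "(nat \<Rightarrow> 'a::topological_space) \<Rightarrow> nat set set \<Rightarrow> (nat \<Rightarrow> nat) set" where
  "Perms_tilde x I = {\<pi> \<in> Perms. ideal_limit_points I (x \<circ> \<pi>) = ideal_limit_points I x}"

end

theory Submission
  imports Defs
begin

text \<open>
  By the Talagrand--Jalali-Naini criterion, an analytic ideal \<open>I\<close> is small: there are finite sets
  \<open>F k \<subseteq> {k..}\<close> such that no member of \<open>I\<close> contains infinitely many of them. For a generic
  subsequence or rearrangement \<open>p\<close>, each point \<open>d\<close> of a countable dense subset of the set \<open>L\<close> of accumulation points, and each basic neighbourhood \<open>U\<close> of \<open>d\<close>, the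
  sequence \<open>x \<circ> p\<close> maps infinitely many \<open>F k\<close> into \<open>U\<close>. For \<open>l \<in> L\<close>, a union of
  such blocks with \<open>U\<close> shrinking to \<open>l\<close> is not in \<open>I\<close>, so \<open>l\<close> is an \<open>I\<close>-limit point.
  Hence generically the set of \<open>I\<close>-limit points is \<open>L\<close>, and the Baire category theorem gives the
  equivalences.
\<close>

section \<open>Cylinders of the Baire space\<close>

definition cyl :: "(nat \<Rightarrow> 'b) \<Rightarrow> nat \<Rightarrow> (nat \<Rightarrow> 'b) set" where
  "cyl y n = {z. \<forall>i<n. z i = y i}"

lemma cyl_mono: "z \<in> cyl y n \<Longrightarrow> n \<le> m \<Longrightarrow> cyl z m \<subseteq> cyl y n"
  by (auto simp: cyl_def)

lemma self_in_cyl: "y \<in> cyl y n"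
  by (simp add: cyl_def)

lemma open_cyl: "open (cyl (y :: nat \<Rightarrow> 'b::discrete_topology) n)"
proof -
  have "cyl y n = Pi\<^sub>E UNIV (\<lambda>i. if i < n then {y i} else UNIV)"
    by (auto simp: cyl_def PiE_UNIV_domain Pi_iff split: if_splits)
  moreover have "finite {i. (if i < n then {y i} else UNIV) \<noteq> UNIV}"
    by (rule finite_subset[of _ "{..<n}"]) auto
  ultimately show ?thesis
    by (auto intro!: open_PiE open_discrete)
qed

text \<open>One \<open>n\<close> serves all points of \<open>W\<close>: this is for conditions that
  read only the first \<open>n\<close> coordinates.\<close>

lemma open_if_cyl:
  fixes W :: "(nat \<Rightarrow> 'b::discrete_topology) set"
  assumes "\<And>y z. y \<in> W \<Longrightarrow> z \<in> cyl y n \<Longrightarrow> z \<in> W"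
  shows "open W"
proof (subst open_subopen, intro ballI exI conjI)
  fix y assume "y \<in> W"
  show "open (cyl y n)" "y \<in> cyl y n" by (simp_all add: open_cyl self_in_cyl)
  show "cyl y n \<subseteq> W" using assms \<open>y \<in> W\<close> by blast
qed

lemma open_contains_cyl:
  fixes y :: "nat \<Rightarrow> 'b::discrete_topology"
  assumes "open W" "y \<in> W"
  obtains n where "cyl y n \<subseteq> W"
proof -
  obtain X where X: "y \<in> Pi\<^sub>E UNIV X" "finite {i. X i \<noteq> UNIV}" "Pi\<^sub>E UNIV X \<subseteq> W"
    using product_topology_open_contains_basis[of "\<lambda>_. euclidean" UNIV W y] assms
    by (auto simp: euclidean_product_topology)
  obtain n where n: "{i. X i \<noteq> UNIV} \<subseteq> {..<n}"
    using finite_nat_bounded[OF X(2)] by blast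
  have "cyl y n \<subseteq> Pi\<^sub>E UNIV X"
  proof
    fix z assume z: "z \<in> cyl y n"
    have "z i \<in> X i" for i
    proof (cases "i < n")
      case True
      then show ?thesis using z X(1) by (auto simp: cyl_def PiE_UNIV_domain Pi_iff)
    next
      case False
      then have "X i = UNIV" using n by auto
      then show ?thesis by simp
    qed
    then show "z \<in> Pi\<^sub>E UNIV X" by (auto simp: PiE_UNIV_domain)
  qed
  then show ?thesis
    using X(3) by (intro that[of n]) (rule order_trans)
qed

lemma nested_cyl_limit:
  assumes "\<And>k. y (Suc k) \<in> cyl (y k) (n k)" "\<And>k. n k < n (Suc k)"
  obtains z where "\<And>k. z \<in> cyl (y k) (n k)"
proof
  have mono: "strict_mono n"
    using assms(2) by (simp add: strict_mono_Suc_iff)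
  have agree: "y (k + j) \<in> cyl (y k) (n k)" for k j
  proof (induction j)
    case (Suc j)
    have "n k \<le> n (k + j)"
      using mono by (simp add: strict_mono_less_eq)
    then have "cyl (y (k + j)) (n (k + j)) \<subseteq> cyl (y k) (n k)"
      by (rule cyl_mono[OF Suc])
    then show ?case
      using assms(1)[of "k + j"] by auto
  qed (simp add: self_in_cyl)
  \<comment> \<open>Coordinate \<open>i\<close> is settled from stage \<open>Suc i\<close> on,
    because \<open>n (Suc i) > i\<close>; stage \<open>i\<close> might still leave it free.\<close>
  define z where "z = (\<lambda>i. y (Suc i) i)"
  show "z \<in> cyl (y k) (n k)" for k
  proof -
    have "y (Suc i) i = y k i" if "i < n k" for i
    proof (cases "k \<le> Suc i")
      case True
      then show ?thesis
        using agree[of k "Suc i - k"] that by (simp add: cyl_def)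
    next
      case False
      have "i < n (Suc i)"
        using strict_mono_imp_increasing[OF mono, of "Suc i"] by simp
      then show ?thesis
        using agree[of "Suc i" "k - Suc i"] False by (simp add: cyl_def)
    qed
    then show ?thesis by (simp add: cyl_def z_def)
  qed
qed

section \<open>Analytic ideals are small\<close>

text \<open>Stated for arbitrary families rather than ideals, so that images of open sets and
  countable unions can be handled; the \<open>F k\<close> may overlap and only have to move off to
  infinity.\<close>

definition small :: "nat set set \<Rightarrow> bool" where
  "small T \<longleftrightarrow> (\<exists>F :: nat \<Rightarrow> nat set. (\<forall>k. finite (F k) \<and> F k \<subseteq> {k..}) \<and>
     (\<forall>A\<in>T. finite {k. F k \<subseteq> A}))"

section \<open>Smallness under subsets and countable unions\<close>

lemma small_empty: "small {}"
  unfolding small_def by (rule exI[of _ "\<lambda>_. {}"]) simp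

lemma small_subset: "small T \<Longrightarrow> S \<subseteq> T \<Longrightarrow> small S"
  unfolding small_def by (erule ex_forward) auto

lemma small_UN:
  assumes "\<And>n :: nat. small (T n)"
  shows "small (\<Union>n. T n)"
proof -
  obtain F where F: "\<And>n k. finite (F n k)" "\<And>n k. F n k \<subseteq> {k..}"
      "\<And>n A. A \<in> T n \<Longrightarrow> finite {k. F n k \<subseteq> A}"
  proof -
    have "\<forall>n. \<exists>F :: nat \<Rightarrow> nat set. (\<forall>k. finite (F k) \<and> F k \<subseteq> {k..}) \<and>
        (\<forall>A\<in>T n. finite {k. F k \<subseteq> A})"
      using assms unfolding small_def by blast
    then obtain F where "\<forall>n. (\<forall>k. finite (F n k) \<and> F n k \<subseteq> {k..}) \<and>
        (\<forall>A\<in>T n. finite {k. F n k \<subseteq> A})"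
      by (auto dest!: choice)
    then show ?thesis
      by (intro that[of F]) auto
  qed
  \<comment> \<open>Merging only the indices up to \<open>k\<close> keeps \<open>G k\<close> finite;
    for \<open>k \<ge> n\<close>, \<open>G k \<subseteq> A\<close> still forces
    \<open>F n k \<subseteq> A\<close>.\<close>
  define G where "G k = (\<Union>n\<le>k. F n k)" for k
  have "finite {k. G k \<subseteq> A}" if "A \<in> T n" for A n
  proof (rule finite_subset)
    show "{k. G k \<subseteq> A} \<subseteq> {..<n} \<union> {k. F n k \<subseteq> A}"
      by (force simp: G_def)
    show "finite ({..<n} \<union> {k. F n k \<subseteq> A})"
      using F(3)[OF that] by simp
  qed
  moreover have "finite (G k)" "G k \<subseteq> {k..}" for k
    unfolding G_def using F(1,2) by (simp, blast)
  ultimately show ?thesis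
    unfolding small_def by (intro exI[of _ G]) auto
qed

lemma small_countable_Union:
  assumes "countable \<T>" "\<And>T. T \<in> \<T> \<Longrightarrow> small T"
  shows "small (\<Union>\<T>)"
proof (cases "\<T> = {}")
  case False
  then have "\<Union>\<T> = (\<Union>n. from_nat_into \<T> n)"
    using assms(1) by (simp add: range_from_nat_into)
  then show ?thesis
    using small_UN[of "from_nat_into \<T>"] assms(2) False by (simp add: from_nat_into)
qed (simp add: small_empty)

lemma small_Un: "small S \<Longrightarrow> small T \<Longrightarrow> small (S \<union> T)"
  using small_countable_Union[of "{S, T}"] by fastforce

text \<open>Otherwise every \<open>a\<close> has an interval starting at or after \<open>a\<close>
  that no member of \<open>T\<close> contains, and these intervals would themselves witness
  smallness.\<close>

lemma not_small_contains_intervals: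
  assumes "\<not> small T"
  shows "\<exists>a. \<forall>m\<ge>a. \<forall>m'. \<exists>A\<in>T. {m..<m'} \<subseteq> A"
proof (rule ccontr)
  assume "\<not> ?thesis"
  then obtain m m' where m: "\<And>a :: nat. m a \<ge> a" "\<And>a A. A \<in> T \<Longrightarrow> \<not> {m a..<m' a} \<subseteq> A"
    by metis
  have "{m a..<m' a} \<subseteq> {a..}" for a
    using m(1)[of a] by auto
  with m(2) have "small T"
    unfolding small_def by (intro exI[of _ "\<lambda>a. {m a..<m' a}"]) simp
  with assms show False ..
qed

text \<open>If the image were not small, discard the open sets with small image and build two points
  \<open>u\<close> and \<open>v\<close> of the rest alternately, so that one of \<open>f u\<close> and \<open>f v\<close> contains each interval of
  a partition of a cofinite set.\<close>

lemma not_small_range_covers: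
  fixes f :: "(nat \<Rightarrow> nat) \<Rightarrow> nat set"
  assumes cont: "\<And>i. open {y. i \<in> f y}" and big: "\<not> small (range f)"
  shows "\<exists>u v a. {a..} \<subseteq> f u \<union> f v"
proof -
  define \<W> where "\<W> = {W. open W \<and> small (f ` W)}"
  \<comment> \<open>By Lindelof, countably many of the discarded open sets have the same union, so
    this union has small image too.\<close>
  obtain \<W>' where W': "\<W>' \<subseteq> \<W>" "countable \<W>'" "\<Union>\<W>' = \<Union>\<W>"
    using Lindelof[of \<W>] by (auto simp: \<W>_def)
  have "small (\<Union>((`) f ` \<W>'))"
    by (rule small_countable_Union) (use W' in \<open>auto simp: \<W>_def\<close>)
  then have small_bad: "small (f ` \<Union>\<W>)"
    using W'(3) by (metis image_Union)
  define G where "G = - \<Union>\<W>"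
  \<comment> \<open>If this piece of \<open>G\<close> had small image, \<open>W\<close> would be one
    of the discarded sets, which are disjoint from \<open>G\<close>.\<close>
  have G_big: "\<not> small (f ` (W \<inter> G))" if "open W" "W \<inter> G \<noteq> {}" for W
  proof
    assume "small (f ` (W \<inter> G))"
    then have "small (f ` (W \<inter> G) \<union> f ` \<Union>\<W>)"
      using small_bad by (rule small_Un)
    then have "small (f ` W)"
      by (rule small_subset) (auto simp: G_def)
    with that show False by (auto simp: \<W>_def G_def)
  qed
  \<comment> \<open>The invariant of the construction: inside \<open>cyl y n\<close> any interval
    from the threshold \<open>a\<close> on can still be absorbed, and this at a point of
    \<open>G\<close>, around which further thresholds exist.\<close>
  define Q where "Q y n a \<longleftrightarrow> (\<forall>m\<ge>a. \<forall>m'. \<exists>z\<in>G \<inter> cyl y n. {m..<m'} \<subseteq> f z)"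
    for y :: "nat \<Rightarrow> nat" and n a :: nat
  have Q_mono: "Q y n a \<Longrightarrow> a \<le> a' \<Longrightarrow> Q y n a'" for y n a a'
    unfolding Q_def by (meson order_trans)
  have Q_ex: "\<exists>a\<ge>b. Q y n a" if "y \<in> G" for y n b
  proof -
    have "\<not> small (f ` (cyl y n \<inter> G))"
      using that self_in_cyl[of y n] by (intro G_big open_cyl) auto
    then obtain a where "Q y n a"
      using not_small_contains_intervals by (fastforce simp: Q_def)
    then show ?thesis
      using Q_mono[of y n a "max a b"] by (intro exI[of _ "max a b"]) auto
  qed
  \<comment> \<open>One move: a point of \<open>G\<close> absorbs \<open>{a..<b}\<close>, and by
    continuity so does a whole cylinder around it. The new threshold \<open>a'\<close> lies beyond
    \<open>b\<close>, leaving the gap \<open>{b..<a'}\<close> to the other point.\<close>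
  have step: "\<exists>z n' a'. z \<in> cyl y n \<and> n < n' \<and> b < a' \<and> Q z n' a' \<and>
      (\<forall>u\<in>cyl z n'. {a..<b} \<subseteq> f u)" if Qa: "Q y n a" for y n a b
  proof -
    obtain z where z: "z \<in> G" "z \<in> cyl y n" "{a..<b} \<subseteq> f z"
      using Qa unfolding Q_def by (metis IntE order_refl)
    have "open (\<Inter>i\<in>{a..<b}. {y. i \<in> f y})"
      using cont by (intro open_INT) auto
    then obtain l where l: "cyl z l \<subseteq> (\<Inter>i\<in>{a..<b}. {y. i \<in> f y})"
      using open_contains_cyl[of "\<Inter>i\<in>{a..<b}. {y. i \<in> f y}" z] z(3) by auto
    define n' where "n' = max l (Suc n)"
    obtain a' where "a' \<ge> Suc b" "Q z n' a'"
      using Q_ex[OF z(1)] by blast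
    moreover have "cyl z n' \<subseteq> cyl z l"
      by (auto simp: cyl_def n'_def)
    ultimately show ?thesis
      using z(2) l by (intro exI[of _ z] exI[of _ n'] exI[of _ a']) (auto simp: n'_def)
  qed
  \<comment> \<open>A state holds cylinder and threshold of \<open>u\<close> in
    \<open>(y, n, a)\<close> and those of \<open>v\<close> in \<open>(w, k, b)\<close>;
    \<open>a < b\<close> means that \<open>u\<close> moves next.\<close>
  define P where "P = (\<lambda>(y, n, a, w, k, b). Q y n a \<and> Q w k b \<and> a < b)"
  define R where "R = (\<lambda>(y, n, a :: nat, w, k, b :: nat) (y', n', a', w', k', b' :: nat).
      y' \<in> cyl y n \<and> n < n' \<and> w' \<in> cyl w k \<and> k < k' \<and> b < a' \<and>
      (\<forall>u\<in>cyl y' n'. {a..<b} \<subseteq> f u) \<and> (\<forall>u\<in>cyl w' k'. {b..<a'} \<subseteq> f u))"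
  have ex0: "\<exists>s. P s"
  proof -
    have "\<Union>\<W> \<noteq> UNIV"
      using big small_bad by metis
    then obtain y where "y \<in> G" by (auto simp: G_def)
    then obtain a b where "Q y 0 a" "b \<ge> Suc a" "Q y 0 b"
      using Q_ex by meson
    then have "P (y, 0, a, y, 0, b)" by (simp add: P_def)
    then show ?thesis ..
  qed
  have exS: "\<exists>s'. P s' \<and> R s s'" if Ps: "P s" for s
  proof -
    obtain y n a w k b where s: "s = (y, n, a, w, k, b)" by (cases s)
    have Q: "Q y n a" "Q w k b" using Ps by (auto simp: P_def s)
    obtain y' n' a' where 1: "y' \<in> cyl y n" "n < n'" "b < a'" "Q y' n' a'"
        "\<forall>u\<in>cyl y' n'. {a..<b} \<subseteq> f u"
      using step[OF Q(1)] by blast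
    obtain w' k' b' where 2: "w' \<in> cyl w k" "k < k'" "a' < b'" "Q w' k' b'"
        "\<forall>u\<in>cyl w' k'. {b..<a'} \<subseteq> f u"
      using step[OF Q(2)] by blast
    show ?thesis
      using 1 2 by (intro exI[of _ "(y', n', a', w', k', b')"]) (simp add: P_def R_def s)
  qed
  obtain s where s: "\<And>j. P (s j)" "\<And>j. R (s j) (s (Suc j))"
    using dependent_nat_choice[of "\<lambda>_. P" "\<lambda>_. R"] ex0 exS by metis
  define y where "y j = fst (s j)" for j
  define n where "n j = fst (snd (s j))" for j
  define a where "a j = fst (snd (snd (s j)))" for j
  define w where "w j = fst (snd (snd (snd (s j))))" for j
  define k where "k j = fst (snd (snd (snd (snd (s j)))))" for j
  define b where "b j = snd (snd (snd (snd (snd (s j)))))" for j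
  have s_eq: "s j = (y j, n j, a j, w j, k j, b j)" for j
    by (simp add: y_def n_def a_def w_def k_def b_def)
  have R: "y (Suc j) \<in> cyl (y j) (n j)" "n j < n (Suc j)" "w (Suc j) \<in> cyl (w j) (k j)"
      "k j < k (Suc j)" "b j < a (Suc j)" "a j < b j"
      "\<And>u. u \<in> cyl (y (Suc j)) (n (Suc j)) \<Longrightarrow> {a j..<b j} \<subseteq> f u"
      "\<And>u. u \<in> cyl (w (Suc j)) (k (Suc j)) \<Longrightarrow> {b j..<a (Suc j)} \<subseteq> f u" for j
    using s(1)[of j] s(2)[of j] unfolding s_eq by (auto simp: P_def R_def)
  obtain u where u: "\<And>j. u \<in> cyl (y j) (n j)"
    using nested_cyl_limit[of y n] R(1,2) by metis
  obtain v where v: "\<And>j. v \<in> cyl (w j) (k j)"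
    using nested_cyl_limit[of w k] R(3,4) by metis
  have block: "{a j..<a (Suc j)} \<subseteq> f u \<union> f v" for j
    using R(7)[OF u] R(8)[OF v] by (fastforce simp: not_less)
  have "{a 0..<a j} \<subseteq> f u \<union> f v" for j
  proof (induction j)
    case (Suc j)
    then show ?case using block[of j] by (fastforce simp: not_less)
  qed simp
  \<comment> \<open>The thresholds increase strictly, so the blocks exhaust
    \<open>{a 0..}\<close>.\<close>
  moreover have "i < a (Suc i)" for i
    using strict_mono_imp_increasing[of a "Suc i"] order.strict_trans[OF R(6) R(5)]
    by (simp add: strict_mono_Suc_iff)
  ultimately have "{a 0..} \<subseteq> f u \<union> f v"
    by fastforce
  then show ?thesis by blast
qed

text \<open>Two members of a proper ideal containing the finite sets cannot cover a cofinite set,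
  but a continuous parametrization of a non-small \<open>I\<close> would yield such a pair.\<close>

lemma analytic_ideal_small:
  assumes "analytic_ideal I"
  shows "small I"
proof (rule ccontr)
  assume big: "\<not> small I"
  have I: "ideal_on_nat I" and an: "analytic_set ((\<lambda>A :: nat set. \<lambda>n. n \<in> A) ` I)"
    using assms by (auto simp: analytic_ideal_def)
  have "I \<noteq> {}" using I by (auto simp: ideal_on_nat_def)
  then obtain g :: "(nat \<Rightarrow> nat) \<Rightarrow> nat \<Rightarrow> bool"
    where g: "continuous_on UNIV g" "range g = (\<lambda>A. \<lambda>n. n \<in> A) ` I"
    using an by (auto simp: analytic_set_def)
  define f where "f y = {i. g y i}" for y
  have "range f = Collect ` range g"
    by (auto simp: f_def)
  then have "range f = I"
    unfolding g(2) by (auto simp: image_image)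
  moreover have "open {y. i \<in> f y}" for i
  proof -
    have "continuous_on UNIV (\<lambda>y. g y i)"
      by (rule continuous_on_product_then_coordinatewise[OF g(1)])
    then have "open ((\<lambda>y. g y i) -` {True})"
      by (rule open_vimage[OF open_discrete])
    moreover have "(\<lambda>y. g y i) -` {True} = {y. i \<in> f y}"
      by (auto simp: f_def)
    ultimately show ?thesis by simp
  qed
  ultimately obtain A B a where AB: "A \<in> I" "B \<in> I" "{a..} \<subseteq> A \<union> B"
    using not_small_range_covers[of f] big by blast
  have "finite {..<a}" by simp
  then have "{..<a} \<in> I" "A \<union> B \<in> I"
    using I AB(1,2) unfolding ideal_on_nat_def by blast+
  then have "{..<a} \<union> (A \<union> B) \<in> I"
    using I unfolding ideal_on_nat_def by blast
  moreover have "{..<a} \<union> (A \<union> B) = UNIV"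
    using AB(3) by (force simp: not_less)
  ultimately show False
    using I unfolding ideal_on_nat_def by (metis UNIV_I UNIV_eq_I subset_UNIV)
qed

section \<open>Baire category\<close>

lemma meager_in_subset:
  assumes "meager_in T S" "S' \<subseteq> S"
  shows "meager_in T S'"
proof -
  obtain F :: "nat \<Rightarrow> _" where F: "\<And>n. nowhere_dense_in T (F n)" "S = (\<Union>n. F n)"
    using assms(1) by (auto simp: meager_in_def)
  have "nowhere_dense_in T (F n \<inter> S')" for n
  proof -
    have "T interior_of (T closure_of (F n \<inter> S')) \<subseteq> T interior_of (T closure_of F n)"
      by (intro interior_of_mono closure_of_mono) auto
    then show ?thesis
      using F(1)[of n] by (auto simp: nowhere_dense_in_def)
  qed
  moreover have "S' = (\<Union>n. F n \<inter> S')"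
    using F(2) assms(2) by auto
  ultimately show ?thesis
    unfolding meager_in_def by (intro exI[of _ "\<lambda>n. F n \<inter> S'"]) auto
qed

lemma meager_in_UN:
  assumes "\<And>n :: nat. meager_in T (S n)"
  shows "meager_in T (\<Union>n. S n)"
proof -
  obtain F :: "nat \<Rightarrow> nat \<Rightarrow> _" where F: "\<And>n k. nowhere_dense_in T (F n k)" "\<And>n. S n = (\<Union>k. F n k)"
    using assms unfolding meager_in_def by metis
  have "(\<Union>n. S n) = (\<Union>j. case_prod F (prod_decode j))"
    unfolding F(2) by (auto, metis prod_encode_inverse case_prod_conv)
  then show ?thesis
    unfolding meager_in_def using F(1)
    by (intro exI[of _ "\<lambda>j. case_prod F (prod_decode j)"]) (auto split: prod.split)
qed

lemma meager_in_Un: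
  assumes "meager_in T A" "meager_in T B"
  shows "meager_in T (A \<union> B)"
proof -
  have "meager_in T (\<Union>n :: nat. if n = 0 then A else B)"
    using assms by (intro meager_in_UN) auto
  then show ?thesis
    by (rule meager_in_subset) (auto intro: exI[of _ "0::nat"] exI[of _ "1::nat"])
qed

lemma comeager_in_Inter:
  assumes "countable \<E>" "\<And>E. E \<in> \<E> \<Longrightarrow> openin T E \<and> T closure_of E = topspace T"
    and "topspace T \<inter> \<Inter>\<E> \<subseteq> S" "S \<subseteq> topspace T"
  shows "comeager_in T S"
proof -
  \<comment> \<open>Inserting the whole space makes the enumerated family nonempty even when
    \<open>\<E>\<close> is empty.\<close>
  define E where "E = from_nat_into (insert (topspace T) \<E>)"
  have E_in: "E n \<in> insert (topspace T) \<E>" for n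
    unfolding E_def by (rule from_nat_into) simp
  have range_E: "range E = insert (topspace T) \<E>"
    using assms(1) by (simp add: E_def range_from_nat_into)
  have E: "openin T (E n)" "T closure_of (E n) = topspace T" for n
    using E_in[of n] assms(2) by auto
  have "nowhere_dense_in T (topspace T - E n)" for n
  proof -
    have "closedin T (topspace T - E n)"
      using E(1) by blast
    then show ?thesis
      using E(2)[of n] by (simp add: nowhere_dense_in_def closure_of_closedin interior_of_complement)
  qed
  then have "meager_in T (\<Union>n. topspace T - E n)"
    unfolding meager_in_def by (intro exI[of _ "\<lambda>n. topspace T - E n"]) simp
  moreover have "topspace T - S \<subseteq> (\<Union>n. topspace T - E n)"
  proof -
    have "topspace T \<inter> \<Inter>(range E) \<subseteq> S"
      using assms(3) unfolding range_E by auto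
    then show ?thesis by blast
  qed
  ultimately have "meager_in T (topspace T - S)"
    by (rule meager_in_subset)
  with assms(4) show ?thesis by (simp add: comeager_in_def)
qed

lemma not_meager_in_topspace:
  assumes "completely_metrizable_space T" "topspace T \<noteq> {}"
  shows "\<not> meager_in T (topspace T)"
proof
  assume "meager_in T (topspace T)"
  then obtain F :: "nat \<Rightarrow> _" where F: "\<And>n. nowhere_dense_in T (F n)" "topspace T = (\<Union>n. F n)"
    by (auto simp: meager_in_def)
  have "T interior_of \<Union>(range (\<lambda>n. T closure_of F n)) = {}"
    by (rule Baire_category_alt) (use assms(1) F(1) in \<open>auto simp: nowhere_dense_in_def\<close>)
  moreover have "\<Union>(range (\<lambda>n. T closure_of F n)) = topspace T"
  proof
    show "topspace T \<subseteq> \<Union>(range (\<lambda>n. T closure_of F n))"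
    proof
      fix t assume "t \<in> topspace T"
      then obtain n where "t \<in> F n" using F(2) by blast
      moreover have "F n \<subseteq> T closure_of F n"
        by (rule closure_of_subset) (use F(2) in blast)
      ultimately show "t \<in> \<Union>(range (\<lambda>n. T closure_of F n))" by blast
    qed
    show "\<Union>(range (\<lambda>n. T closure_of F n)) \<subseteq> topspace T"
      using closure_of_subset_topspace[of T] by (intro Union_least) auto
  qed
  ultimately show False
    using assms(2) by simp
qed

section \<open>Complete metrizability of the spaces of subsequences and rearrangements\<close>

lemma completely_metrizable_baire_space:
  "completely_metrizable_space (euclidean :: (nat \<Rightarrow> nat) topology)"
proof -
  have "(euclidean :: nat topology) = discrete_topology UNIV"
    by (simp add: topology_eq open_discrete flip: open_openin)
  then have "completely_metrizable_space (euclidean :: nat topology)"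
    by (simp add: completely_metrizable_space_discrete_topology)
  then show ?thesis
    unfolding euclidean_product_topology[symmetric]
    by (auto simp: completely_metrizable_space_product_topology)
qed

lemma gdelta_in_INT:
  fixes S :: "'i::countable \<Rightarrow> 'a set"
  assumes "\<And>i. gdelta_in X (S i)"
  shows "gdelta_in X (\<Inter>i. S i)"
  by (rule gdelta_in_Inter) (use assms in auto)

text \<open>A G-delta subset of a completely metrizable space is completely metrizable, so this
  makes Baire's theorem available in the subspace.\<close>

lemma gdelta_in_Sig: "gdelta_in euclidean Sig"
proof -
  have eq: "Sig = (\<Inter>i. {\<sigma>. \<sigma> i < \<sigma> (Suc i)})"
    by (auto simp: Sig_def strict_mono_Suc_iff)
  have "open {\<sigma> :: nat \<Rightarrow> nat. \<sigma> i < \<sigma> (Suc i)}" for i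
    by (rule open_if_cyl[of _ "Suc (Suc i)"]) (simp add: cyl_def)
  then show ?thesis
    unfolding eq by (intro gdelta_in_INT open_imp_gdelta_in) simp
qed

text \<open>Injectivity is a countable family of conditions on two coordinates; surjectivity asks
  that each \<open>m\<close> be a value, an open condition.\<close>

lemma gdelta_in_Perms: "gdelta_in euclidean Perms"
proof -
  have eq: "Perms = (\<Inter>i. \<Inter>j. {\<pi>. \<pi> i = \<pi> j \<longrightarrow> i = j}) \<inter> (\<Inter>m. {\<pi>. \<exists>i. \<pi> i = m})"
    by (auto simp: Perms_def bij_def inj_def surj_def) metis+
  have "open {\<pi> :: nat \<Rightarrow> nat. \<pi> i = \<pi> j \<longrightarrow> i = j}" for i j
    by (rule open_if_cyl[of _ "Suc (max i j)"]) (simp add: cyl_def less_Suc_eq_le)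
  then have inj: "gdelta_in euclidean {\<pi> :: nat \<Rightarrow> nat. \<pi> i = \<pi> j \<longrightarrow> i = j}" for i j
    by (intro open_imp_gdelta_in) simp
  have "open {\<pi> :: nat \<Rightarrow> nat. \<pi> i = m}" for i m
    by (rule open_if_cyl[of _ "Suc i"]) (simp add: cyl_def)
  then have surj: "gdelta_in euclidean {\<pi> :: nat \<Rightarrow> nat. \<exists>i. \<pi> i = m}" for m
    by (intro open_imp_gdelta_in) (simp add: open_Collect_ex)
  show ?thesis
    unfolding eq by (intro gdelta_in_Int gdelta_in_INT inj surj)
qed

section \<open>Generic subsequences and rearrangements\<close>

lemma Sig_extension:
  assumes "\<sigma> \<in> Sig" "infinite A"
  obtains \<tau> where "\<tau> \<in> Sig" "\<tau> \<in> cyl \<sigma> m" "\<tau> ` {m..} \<subseteq> A"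
proof
  \<comment> \<open>What remains of \<open>A\<close> exceeds all kept values; cutting at
    \<open>\<sigma> m\<close> rather than at the last kept value covers \<open>m = 0\<close> as
    well.\<close>
  let ?A = "A - {..\<sigma> m}"
  let ?\<tau> = "\<lambda>i. if i < m then \<sigma> i else enumerate ?A (i - m)"
  have inf: "infinite ?A" using assms(2) by simp
  have mem: "enumerate ?A i \<in> ?A" for i
    using enumerate_in_set[OF inf] .
  have "strict_mono \<sigma>" using assms(1) by (simp add: Sig_def)
  then have "\<sigma> i < enumerate ?A j" if "i < m" for i j
    using mem[of j] strict_monoD[of \<sigma> i m] that by fastforce
  then show "?\<tau> \<in> Sig"
    using \<open>strict_mono \<sigma>\<close> enumerate_step[OF inf]
    by (auto simp: Sig_def strict_mono_Suc_iff Suc_diff_le)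
  show "?\<tau> \<in> cyl \<sigma> m" by (simp add: cyl_def)
  show "?\<tau> ` {m..} \<subseteq> A" using mem by auto
qed

lemma finite_inj_on_extends_to_bij:
  fixes f :: "nat \<Rightarrow> nat"
  assumes "finite D" "inj_on f D"
  shows "\<exists>\<pi>. bij \<pi> \<and> (\<forall>i\<in>D. \<pi> i = f i)"
proof -
  have "infinite (- D)" "infinite (- f ` D)"
    using assms(1) by (auto simp: finite_compl)
  then obtain g where g: "bij_betw g (- D) (- f ` D)"
    using bij_betw_trans[OF bij_betw_inv_into[OF bij_enumerate] bij_enumerate] by blast
  let ?\<pi> = "\<lambda>i. if i \<in> D then f i else g i"
  have "bij_betw ?\<pi> D (f ` D)"
    using assms(2) by (auto simp: bij_betw_def inj_on_def)
  moreover have "bij_betw ?\<pi> (- D) (- f ` D)"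
    using g by (subst bij_betw_cong[of _ _ g]) auto
  ultimately have "bij_betw ?\<pi> (D \<union> - D) (f ` D \<union> - f ` D)"
    by (rule bij_betw_combine) auto
  then show ?thesis
    by (intro exI[of _ ?\<pi>]) (auto simp: Compl_partition)
qed

text \<open>Only a finite block is sent into \<open>A\<close>, since a bijection cannot send a whole
  tail into a set with infinite complement.\<close>

lemma Perms_extension:
  assumes "\<pi> \<in> Perms" "infinite A" "finite F" "F \<subseteq> {m..}"
  obtains \<rho> where "\<rho> \<in> Perms" "\<rho> \<in> cyl \<pi> m" "\<rho> ` F \<subseteq> A"
proof -
  \<comment> \<open>Removing the values taken below \<open>m\<close> keeps the map injective;
    surjectivity is regained by extending its restriction to a finite set.\<close>
  let ?A = "A - \<pi> ` {..<m}"
  let ?f = "\<lambda>i. if i < m then \<pi> i else enumerate ?A i"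
  have inf: "infinite ?A" using assms(2) by simp
  have mem: "enumerate ?A i \<in> ?A" for i
    using enumerate_in_set[OF inf] .
  have "inj \<pi>" "inj (enumerate ?A)"
    using assms(1) strict_mono_imp_inj_on[OF strict_mono_enumerate[OF inf]]
    by (auto simp: Perms_def bij_def)
  moreover have "\<pi> i \<noteq> enumerate ?A j" if "i < m" for i j
    using mem[of j] that by (metis DiffD2 image_eqI lessThan_iff)
  ultimately have "inj ?f"
    unfolding inj_def by (metis (full_types))
  then have inj: "inj_on ?f ({..<m} \<union> F)"
    by (rule inj_on_subset) simp
  have fin: "finite ({..<m} \<union> F)" using assms(3) by simp
  obtain \<rho> where \<rho>: "bij \<rho>" "\<And>i. i \<in> {..<m} \<union> F \<Longrightarrow> \<rho> i = ?f i"
    using finite_inj_on_extends_to_bij[OF fin inj] by metis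
  show ?thesis
  proof
    show "\<rho> \<in> Perms" using \<rho>(1) by (simp add: Perms_def)
    show "\<rho> \<in> cyl \<pi> m" using \<rho>(2) by (simp add: cyl_def)
    show "\<rho> ` F \<subseteq> A"
    proof
      fix j assume "j \<in> \<rho> ` F"
      then obtain i where i: "i \<in> F" "j = \<rho> i" by auto
      then have "\<rho> i = enumerate ?A i" using \<rho>(2)[of i] assms(4) by auto
      then show "j \<in> A" using mem[of i] i by auto
    qed
  qed
qed

section \<open>Accumulation points and ideal limit points\<close>

lemma closed_accumulation_points: "closed (accumulation_points x)"
proof -
  have "open (- accumulation_points x)"
  proof (subst open_subopen, safe)
    fix l assume "l \<notin> accumulation_points x"
    then obtain U where U: "open U" "l \<in> U" "finite {n. x n \<in> U}"
      by (auto simp: accumulation_points_def)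
    then have "U \<subseteq> - accumulation_points x"
      by (auto simp: accumulation_points_def)
    with U show "\<exists>T. open T \<and> l \<in> T \<and> T \<subseteq> - accumulation_points x" by blast
  qed
  then show ?thesis by (simp add: closed_def)
qed

text \<open>A tail of the subsequence stays in \<open>U\<close>, and injectivity of \<open>p\<close>
  turns its infinitely many positions into infinitely many indices of \<open>x\<close>.\<close>

lemma ideal_limit_points_inj_subset:
  assumes "inj p"
  shows "ideal_limit_points I (x \<circ> p) \<subseteq> accumulation_points x"
proof
  fix l assume "l \<in> ideal_limit_points I (x \<circ> p)"
  then obtain k where k: "strict_mono k" "(x \<circ> p \<circ> k) \<longlonglongrightarrow> l"
    by (auto simp: ideal_limit_points_def)
  have "infinite {n. x n \<in> U}" if U: "open U" "l \<in> U" for U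
  proof -
    obtain N where N: "\<And>i. i \<ge> N \<Longrightarrow> x (p (k i)) \<in> U"
      using topological_tendstoD[OF k(2) U] by (auto simp: eventually_sequentially)
    have "inj (\<lambda>i. p (k i))"
      using inj_compose[OF assms strict_mono_imp_inj_on[OF k(1)]] by (simp add: comp_def)
    then have "infinite ((\<lambda>i. p (k i)) ` {N..})"
      by (meson finite_imageD infinite_Ici inj_on_subset subset_UNIV)
    moreover have "(\<lambda>i. p (k i)) ` {N..} \<subseteq> {n. x n \<in> U}"
      using N by auto
    ultimately show ?thesis by (rule infinite_super[rotated])
  qed
  then show "l \<in> accumulation_points x"
    by (simp add: accumulation_points_def)
qed

text \<open>A union of blocks \<open>F (k i)\<close> on which \<open>y\<close> lies in the
  \<open>i\<close>-th set of a neighbourhood base contains infinitely many \<open>F j\<close>, so it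
  is not in \<open>I\<close>, and \<open>y\<close> converges to \<open>l\<close> along it.\<close>

lemma ideal_limit_pointI:
  fixes y :: "nat \<Rightarrow> 'a::first_countable_topology"
  assumes I: "ideal_on_nat I"
    and F: "\<And>k :: nat. finite (F k)" "\<And>A. A \<in> I \<Longrightarrow> finite {k. F k \<subseteq> A}"
    and near: "\<And>U m. open U \<Longrightarrow> l \<in> U \<Longrightarrow> \<exists>k\<ge>m. \<forall>n\<in>F k. y n \<in> U"
  shows "l \<in> ideal_limit_points I y"
proof -
  obtain A :: "nat \<Rightarrow> 'a set" where A: "\<And>i. open (A i)" "\<And>i. l \<in> A i"
      "\<And>U. open U \<Longrightarrow> l \<in> U \<Longrightarrow> eventually (\<lambda>i. A i \<subseteq> U) sequentially"
    by (rule countable_basis_at_decseq[of l]) blast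
  have "\<exists>k\<ge>i. \<forall>n\<in>F k. y n \<in> A i" for i :: nat
    using near A(1,2) by blast
  then obtain k where k: "\<And>i. k i \<ge> i" "\<And>i n. n \<in> F (k i) \<Longrightarrow> y n \<in> A i"
    by metis
  define S where "S = (\<Union>i. F (k i))"
  have "infinite (range k)"
    using k(1) by (metis finite_nat_set_iff_bounded less_le_not_le rangeI)
  moreover have "range k \<subseteq> {j. F j \<subseteq> S}"
    by (auto simp: S_def)
  ultimately have "infinite {j. F j \<subseteq> S}"
    by (rule infinite_super[rotated])
  then have "S \<notin> I" using F(2) by blast
  then have "infinite S"
    using I by (auto simp: ideal_on_nat_def)
  have conv: "(y \<circ> enumerate S) \<longlonglongrightarrow> l"
  proof (rule topological_tendstoI)
    fix U assume "open U" "l \<in> U"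
    then obtain N where N: "\<And>i. i \<ge> N \<Longrightarrow> A i \<subseteq> U"
      using A(3) by (auto simp: eventually_sequentially)
    \<comment> \<open>Only the first \<open>N\<close> blocks may miss \<open>U\<close>; their union
      is finite, so elements of \<open>S\<close> from \<open>M\<close> on come from later
      blocks.\<close>
    have "finite (\<Union>i<N. F (k i))" using F(1) by simp
    then obtain M where M: "(\<Union>i<N. F (k i)) \<subseteq> {..<M}"
      using finite_nat_bounded by blast
    have "y (enumerate S j) \<in> U" if "j \<ge> M" for j
    proof -
      have "enumerate S j \<ge> M"
        using le_enumerate[OF \<open>infinite S\<close>, of j] that by simp
      moreover obtain i where i: "enumerate S j \<in> F (k i)"
        using enumerate_in_set[OF \<open>infinite S\<close>, of j] by (auto simp: S_def)
      ultimately have "i \<ge> N" using M by (force simp: not_less[symmetric])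
      then show ?thesis using N k(2)[OF i] by blast
    qed
    then show "eventually (\<lambda>j. (y \<circ> enumerate S) j \<in> U) sequentially"
      by (auto simp: eventually_sequentially)
  qed
  show ?thesis
    unfolding ideal_limit_points_def
    using conv strict_mono_enumerate[OF \<open>infinite S\<close>] range_enumerate[OF \<open>infinite S\<close>] \<open>S \<notin> I\<close>
    by auto
qed

text \<open>The hypothesis \<open>ext\<close> captures what subsequences and rearrangements share: a
  finite block beyond \<open>m\<close> can be steered into \<open>A\<close> without touching the
  first \<open>m\<close> values. It gives density of the countably many open requirements
  \<open>E d i m\<close>.\<close>

lemma comeager_limit_points_eq_accumulation_points:
  fixes x :: "nat \<Rightarrow> 'a::first_countable_topology"
  assumes I: "ideal_on_nat I" "small I"
    and sep: "separable_space (top_of_set (accumulation_points x))"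
    and inj: "\<And>p. p \<in> P \<Longrightarrow> inj p"
    and ext: "\<And>p A m F. p \<in> P \<Longrightarrow> infinite A \<Longrightarrow> finite F \<Longrightarrow> F \<subseteq> {m..} \<Longrightarrow>
       \<exists>q\<in>P. q \<in> cyl p m \<and> q ` F \<subseteq> A"
  shows "comeager_in (top_of_set P)
    {p \<in> P. ideal_limit_points I (x \<circ> p) = accumulation_points x}"
proof -
  obtain F where F: "\<And>k. finite (F k)" "\<And>k. F k \<subseteq> {k..}" "\<And>A. A \<in> I \<Longrightarrow> finite {k. F k \<subseteq> A}"
    using I(2) unfolding small_def by metis
  obtain D where D: "countable D" "D \<subseteq> accumulation_points x"
      "top_of_set (accumulation_points x) closure_of D = accumulation_points x"
    using sep by (auto simp: separable_space_def)
  have "\<exists>B :: nat \<Rightarrow> 'a set. (\<forall>i. open (B i) \<and> d \<in> B i) \<and>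
      (\<forall>U. open U \<longrightarrow> d \<in> U \<longrightarrow> (\<exists>i. B i \<subseteq> U))" for d
    using first_countable_basis[of d] by auto
  then obtain B :: "'a \<Rightarrow> nat \<Rightarrow> 'a set" where B: "\<And>d i. open (B d i)" "\<And>d i. d \<in> B d i"
      "\<And>d U. open U \<Longrightarrow> d \<in> U \<Longrightarrow> \<exists>i. B d i \<subseteq> U"
    by metis
  define E where "E d i m = {p \<in> P. \<exists>k\<ge>m. \<forall>n\<in>F k. x (p n) \<in> B d i}" for d i and m :: nat
  define \<E> where "\<E> = (\<lambda>(d, i, m). E d i m) ` (D \<times> UNIV \<times> UNIV)"
  show ?thesis
  proof (rule comeager_in_Inter[of \<E>])
    show "countable \<E>" using D(1) by (auto simp: \<E>_def)
  next
    fix E' assume "E' \<in> \<E>"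
    then obtain d i m where d: "d \<in> D" and E': "E' = E d i m" by (auto simp: \<E>_def)
    have "openin (top_of_set P) (E d i m)"
    proof (subst openin_subopen, safe)
      fix p assume "p \<in> E d i m"
      then obtain k where p: "p \<in> P" "k \<ge> m" "\<forall>n\<in>F k. x (p n) \<in> B d i"
        by (auto simp: E_def)
      \<comment> \<open>One finite block witnesses membership, hence finitely many coordinates of
        \<open>p\<close> decide it.\<close>
      obtain N where "F k \<subseteq> {..<N}"
        using finite_nat_bounded[OF F(1)] by blast
      with p have "P \<inter> cyl p N \<subseteq> E d i m"
        by (fastforce simp: E_def cyl_def)
      moreover have "openin (top_of_set P) (P \<inter> cyl p N)"
        by (intro openin_open_Int open_cyl)
      ultimately show "\<exists>T. openin (top_of_set P) T \<and> p \<in> T \<and> T \<subseteq> E d i m"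
        using p(1) self_in_cyl by blast
    qed
    moreover have "top_of_set P closure_of E d i m = P"
    proof -
      have "\<exists>q\<in>E d i m. q \<in> W" if W: "openin (top_of_set P) W" "p \<in> W" for p W
      proof -
        obtain V where V: "open V" "W = P \<inter> V"
          using W(1) by (auto simp: openin_open)
        then obtain N where N: "cyl p N \<subseteq> V"
          using open_contains_cyl[of V p] W(2) by blast
        have "infinite {n. x n \<in> B d i}"
          using D(2) d B(1,2) by (auto simp: accumulation_points_def)
        \<comment> \<open>The index \<open>max m N\<close> serves twice: it is at least
          \<open>m\<close>, as \<open>E d i m\<close> asks, and at least \<open>N\<close>, so the
          block avoids the coordinates fixed by the cylinder.\<close>
        moreover have "F (max m N) \<subseteq> {N..}"
          using F(2)[of "max m N"] by auto
        ultimately obtain q where q: "q \<in> P" "q \<in> cyl p N" "q ` F (max m N) \<subseteq> {n. x n \<in> B d i}"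
          using ext[of p "{n. x n \<in> B d i}" "F (max m N)" N] F(1) W(2) V(2) by blast
        then have "q \<in> E d i m"
          by (auto simp: E_def intro!: exI[of _ "max m N"])
        then show ?thesis using q N V(2) by auto
      qed
      then show ?thesis
        by (auto simp: set_eq_iff in_closure_of)
    qed
    ultimately show "openin (top_of_set P) E' \<and> top_of_set P closure_of E' = topspace (top_of_set P)"
      by (simp add: E')
  next
    have "ideal_limit_points I (x \<circ> p) = accumulation_points x" if p: "p \<in> P" "p \<in> \<Inter>\<E>" for p
    proof
      show "ideal_limit_points I (x \<circ> p) \<subseteq> accumulation_points x"
        by (rule ideal_limit_points_inj_subset[OF inj[OF p(1)]])
      show "accumulation_points x \<subseteq> ideal_limit_points I (x \<circ> p)"
      proof
        fix l assume l: "l \<in> accumulation_points x"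
        show "l \<in> ideal_limit_points I (x \<circ> p)"
        proof (rule ideal_limit_pointI[OF I(1) F(1,3)])
          fix U and m :: nat assume U: "open U" "l \<in> U"
          have "l \<in> top_of_set (accumulation_points x) closure_of D"
            using l D(3) by simp
          \<comment> \<open>The point \<open>l\<close> need not be in \<open>D\<close>, but
            \<open>U\<close> is also a neighbourhood of some \<open>d\<close> in \<open>D\<close>
            and so contains some \<open>B d i\<close>.\<close>
          then obtain d where d: "d \<in> D" "d \<in> U"
            using U openin_open_Int[OF U(1), of "accumulation_points x"] l
            unfolding in_closure_of by blast
          then obtain i where i: "B d i \<subseteq> U"
            using B(3)[OF U(1)] by blast
          have "E d i m \<in> \<E>"
            using d(1) by (force simp: \<E>_def)
          then have "p \<in> E d i m" using p(2) by blast
          then show "\<exists>k\<ge>m. \<forall>n\<in>F k. (x \<circ> p) n \<in> U"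
            using i by (fastforce simp: E_def)
        qed
      qed
    qed
    then show "topspace (top_of_set P) \<inter> \<Inter>\<E> \<subseteq>
        {p \<in> P. ideal_limit_points I (x \<circ> p) = accumulation_points x}"
      by auto
  qed auto
qed

text \<open>Fibres of \<open>\<phi>\<close> over different values are disjoint, so for
  \<open>M \<noteq> L\<close> the fibre of \<open>M\<close> lies in the meager complement of that of
  \<open>L\<close>; by Baire's theorem a comeager set is not meager.\<close>

lemma comeager_fiber_iff:
  assumes "completely_metrizable_space (top_of_set P)" "P \<noteq> {}"
    and gen: "comeager_in (top_of_set P) {p \<in> P. \<phi> p = L}"
  shows "comeager_in (top_of_set P) {p \<in> P. \<phi> p = M} \<longleftrightarrow> M = L"
    and "\<not> meager_in (top_of_set P) {p \<in> P. \<phi> p = M} \<longleftrightarrow> M = L"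
proof -
  have nm: "\<not> meager_in (top_of_set P) P"
    using not_meager_in_topspace[OF assms(1)] assms(2) by simp
  have m: "meager_in (top_of_set P) (P - {p \<in> P. \<phi> p = L})"
    using gen by (simp add: comeager_in_def)
  have *: "\<not> meager_in (top_of_set P) S" if "comeager_in (top_of_set P) S" for S
  proof
    assume "meager_in (top_of_set P) S"
    with that have "meager_in (top_of_set P) (S \<union> (P - S))"
      by (intro meager_in_Un) (auto simp: comeager_in_def)
    then have "meager_in (top_of_set P) P"
      by (rule meager_in_subset) auto
    with nm show False ..
  qed
  have "meager_in (top_of_set P) {p \<in> P. \<phi> p = M}" if "M \<noteq> L"
    by (rule meager_in_subset[OF m]) (use that in auto)
  with * gen show "comeager_in (top_of_set P) {p \<in> P. \<phi> p = M} \<longleftrightarrow> M = L"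
    and "\<not> meager_in (top_of_set P) {p \<in> P. \<phi> p = M} \<longleftrightarrow> M = L"
    by blast+
qed

theorem theorem2p9:
  fixes x :: "nat \<Rightarrow> 'a :: {first_countable_topology, t2_space}"
    and I :: "nat set set"
  assumes "\<And>C :: 'a set. closed C \<Longrightarrow> separable_space (top_of_set C)"
    and "P_ideal I" and "analytic_ideal I"
  shows "(comeager_in (top_of_set Sig) (Sig_tilde x I)
            \<longleftrightarrow> \<not> meager_in (top_of_set Sig) (Sig_tilde x I)) \<and>
         (\<not> meager_in (top_of_set Sig) (Sig_tilde x I)
            \<longleftrightarrow> comeager_in (top_of_set Perms) (Perms_tilde x I)) \<and>
         (comeager_in (top_of_set Perms) (Perms_tilde x I)
            \<longleftrightarrow> \<not> meager_in (top_of_set Perms) (Perms_tilde x I)) \<and>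
         (\<not> meager_in (top_of_set Perms) (Perms_tilde x I)
            \<longleftrightarrow> ideal_limit_points I x = accumulation_points x)"
proof -
  have I: "ideal_on_nat I" "small I"
    using assms(3) analytic_ideal_small by (auto simp: analytic_ideal_def)
  have sep: "separable_space (top_of_set (accumulation_points x))"
    by (intro assms(1) closed_accumulation_points)
  have "\<exists>\<tau>\<in>Sig. \<tau> \<in> cyl \<sigma> m \<and> \<tau> ` F \<subseteq> A"
    if A: "\<sigma> \<in> Sig" "infinite A" and F: "finite F" "F \<subseteq> {m..}" for \<sigma> A m F
  proof -
    obtain \<tau> where \<tau>: "\<tau> \<in> Sig" "\<tau> \<in> cyl \<sigma> m" "\<tau> ` {m..} \<subseteq> A"
      by (rule Sig_extension[OF A])
    have "\<tau> ` F \<subseteq> A" using \<tau>(3) F(2) by blast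
    with \<tau> show ?thesis by blast
  qed
  then have Sig: "comeager_in (top_of_set Sig)
      {\<sigma> \<in> Sig. ideal_limit_points I (x \<circ> \<sigma>) = accumulation_points x}"
    by (intro comeager_limit_points_eq_accumulation_points[OF I sep])
      (auto simp: Sig_def strict_mono_imp_inj_on)
  have "\<exists>\<rho>\<in>Perms. \<rho> \<in> cyl \<pi> m \<and> \<rho> ` F \<subseteq> A"
    if "\<pi> \<in> Perms" "infinite A" "finite F" "F \<subseteq> {m..}" for \<pi> A m F
    by (rule Perms_extension[OF that]) blast
  then have Perms: "comeager_in (top_of_set Perms)
      {\<pi> \<in> Perms. ideal_limit_points I (x \<circ> \<pi>) = accumulation_points x}"
    by (intro comeager_limit_points_eq_accumulation_points[OF I sep])
      (auto simp: Perms_def bij_def)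
  have "id \<in> Sig" "id \<in> Perms"
    by (auto simp: Sig_def Perms_def strict_mono_def)
  then have ne: "Sig \<noteq> {}" "Perms \<noteq> {}" by auto
  note cm = completely_metrizable_space_gdelta_in[OF completely_metrizable_baire_space]
  \<comment> \<open>With \<open>\<phi> p\<close> the set of limit points of
    \<open>x \<circ> p\<close>, \<open>L\<close> the accumulation points and \<open>M\<close> the
    limit points of \<open>x\<close>, each of the four category statements reduces to
    \<open>M = L\<close>.\<close>
  show ?thesis
    unfolding Sig_tilde_def Perms_tilde_def
    using comeager_fiber_iff[OF cm[OF gdelta_in_Sig] ne(1) Sig]
      comeager_fiber_iff[OF cm[OF gdelta_in_Perms] ne(2) Perms]
    by simp
qed

end
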